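(* Let $\beta$ be a stable non-negative increasing sequence tending to infinity, let $K(a_{n,k})$ be a Köthe space, and let $\theta=(\theta_n)_{n\in\mathbb{N}_0}\in\Lambda_1(\beta)$. Assume that for every $k\in\mathbb{N}$ there exist $m\in\mathbb{N}$ and $C>0$ such that $$e^{\frac1k\beta_n}\le C\,a_{n,m}\qquad\text{for all }n\in\mathbb{N}.$$ Then the Hankel operator $H_\theta:K(a_{n,k})\to\Lambda_1(\beta)$ is well-defined and continuous.
   Context: $\mathbb{N}=\{1,2,\dots\}$, $\mathbb{N}_0=\mathbb{N}\cup\{0\}$. A Köthe matrix is a matrix $(a_{n,k})_{n,k\in\mathbb{N}}$ of non-negative numbers such that for each $n$ there is $k$ with $a_{n,k}>0$, and $a_{n,k}\le a_{n,k+1}$ for all $n,k$. The associated Köthe space is the Fréchet space $K(a_{n,k})=\{x=(x_n)_{n\in\mathbb{N}}:\ \|x\|_k:=\sum_{n=1}^\infty|x_n|a_{n,k}<\infty\ \text{for all }k\in\mathbb{N}\}$ with seminorms $\|\cdot\|_k$, $k\in\mathbb{N}$. For a non-negative increasing sequence $\beta=(\beta_n)_{n\in\mathbb{N}}$ with $\beta_n\to\infty$, the power series space of finite type is $\Lambda_1(\beta)=K(e^{-\frac1k\beta_n})$, i.e. $\|x\|_k=\sum_{n=1}^\infty|x_n|e^{-\frac1k\beta_n}$. The sequence $\beta$ is stable if $\sup_{n\in\mathbb{N}}\beta_{2n}/\beta_n<\infty$, i.e. there is $M$ with $\beta_{2n}\le M\beta_n$ for all $n$. The sequence $e_n$ has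 $1$ in the $n$-th place and $0$ elsewhere. A sequence $\theta=(\theta_n)_{n\in\mathbb{N}_0}$ is identified with the sequence $(\theta_{n-1})_{n\in\mathbb{N}}=(\theta_0,\theta_1,\theta_2,\dots)$ when it is said to belong to a sequence space. The Hankel operator $H_\theta$ from a Köthe space $E$ to a Köthe space $F$ is given by $H_\theta e_n=(\theta_{n-1},\theta_n,\theta_{n+1},\dots)=\sum_{j=1}^\infty\theta_{j+n-2}e_j$ for $n\in\mathbb{N}$ and $H_\theta x=\sum_{n=1}^\infty x_nH_\theta e_n$ for $x=(x_n)\in E$. It is well-defined if $H_\theta e_n\in F$ for all $n$ and the series $\sum_n x_nH_\theta e_n$ converges in $F$ for every $x\in E$. *)

theory Defs
  imports "HOL-Analysis.Analysis"
begin

text \<open>Indices \<^term>\<open>n\<close>, \<^term>\<open>k\<close> range over \<open>{1, 2, \<dots>}\<close>.  A sequence indexed by this set is a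
  function on \<^typ>\<open>nat\<close>; for elements of a sequence space the unused value at \<open>0\<close> is
  normalised to \<open>0\<close>, so that distinct functions are distinct sequences.  Entries of matrices
  and of exponent sequences at index \<open>0\<close> are never inspected.  The scalars are a complete
  normed field over the reals, that is, the real or the complex numbers.\<close>

definition kothe_matrix :: "(nat \<Rightarrow> nat \<Rightarrow> real) \<Rightarrow> bool" where
  "kothe_matrix a \<longleftrightarrow>
     (\<forall>n\<ge>1. \<forall>k\<ge>1. 0 \<le> a n k) \<and>
     (\<forall>n\<ge>1. \<exists>k\<ge>1. 0 < a n k) \<and>
     (\<forall>n\<ge>1. \<forall>k\<ge>1. a n k \<le> a n (k + 1))"

definition kothe_space ::
    "(nat \<Rightarrow> nat \<Rightarrow> real) \<Rightarrow> (nat \<Rightarrow> 'a::{real_normed_field, banach}) set" where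
  "kothe_space a =
     {x. x 0 = 0 \<and> (\<forall>k\<ge>1. (\<lambda>n. norm (x n) * a n k) summable_on {1..})}"

definition kothe_seminorm ::
    "(nat \<Rightarrow> nat \<Rightarrow> real) \<Rightarrow> nat \<Rightarrow> (nat \<Rightarrow> 'a::{real_normed_field, banach}) \<Rightarrow> real" where
  "kothe_seminorm a k x = (\<Sum>\<^sub>\<infinity>n\<in>{1..}. norm (x n) * a n k)"

definition kothe_ball ::
    "(nat \<Rightarrow> nat \<Rightarrow> real) \<Rightarrow> nat \<Rightarrow> (nat \<Rightarrow> 'a::{real_normed_field, banach}) \<Rightarrow> real
     \<Rightarrow> (nat \<Rightarrow> 'a) set" where
  "kothe_ball a k x \<epsilon> = {y \<in> kothe_space a. kothe_seminorm a k (\<lambda>n. y n - x n) < \<epsilon>}"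

text \<open>The Frechet topology of the Koethe space: the locally convex topology defined by its
  seminorms, with the seminorm balls as a subbase.\<close>

definition kothe_topology ::
    "(nat \<Rightarrow> nat \<Rightarrow> real) \<Rightarrow> (nat \<Rightarrow> 'a::{real_normed_field, banach}) topology" where
  "kothe_topology a =
     topology_generated_by {kothe_ball a k x \<epsilon> | k x \<epsilon>. 1 \<le> k \<and> x \<in> kothe_space a \<and> 0 < \<epsilon>}"

definition power_series_matrix :: "(nat \<Rightarrow> real) \<Rightarrow> nat \<Rightarrow> nat \<Rightarrow> real" where
  "power_series_matrix \<beta> n k = exp (- (1 / real k) * \<beta> n)"

abbreviation power_series_space ::
    "(nat \<Rightarrow> real) \<Rightarrow> (nat \<Rightarrow> 'a::{real_normed_field, banach}) set" where
  "power_series_space \<beta> \<equiv> kothe_space (power_series_matrix \<beta>)"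

abbreviation power_series_topology ::
    "(nat \<Rightarrow> real) \<Rightarrow> (nat \<Rightarrow> 'a::{real_normed_field, banach}) topology" where
  "power_series_topology \<beta> \<equiv> kothe_topology (power_series_matrix \<beta>)"

text \<open>The quotient \<open>\<beta>\<^sub>2\<^sub>n / \<beta>\<^sub>n\<close> is avoided because \<open>\<beta>\<^sub>n\<close> may vanish.\<close>

definition stable_seq :: "(nat \<Rightarrow> real) \<Rightarrow> bool" where
  "stable_seq \<beta> \<longleftrightarrow> (\<exists>M. \<forall>n\<ge>1. \<beta> (2 * n) \<le> M * \<beta> n)"

text \<open>A sequence indexed from \<open>0\<close>, re-indexed from \<open>1\<close>.\<close>

definition reindex :: "(nat \<Rightarrow> 'a::zero) \<Rightarrow> nat \<Rightarrow> 'a" where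
  "reindex \<theta> n = (if n = 0 then 0 else \<theta> (n - 1))"

text \<open>The image of the \<open>n\<close>-th unit sequence.  For \<open>n, j \<ge> 1\<close> the subtraction does not truncate.\<close>

definition hankel_column :: "(nat \<Rightarrow> 'a::zero) \<Rightarrow> nat \<Rightarrow> nat \<Rightarrow> 'a" where
  "hankel_column \<theta> n j = (if j = 0 then 0 else \<theta> (j + n - 2))"

definition hankel_partial_sum ::
    "(nat \<Rightarrow> 'a::{real_normed_field, banach}) \<Rightarrow> (nat \<Rightarrow> 'a) \<Rightarrow> nat \<Rightarrow> nat \<Rightarrow> 'a" where
  "hankel_partial_sum \<theta> x N = (\<lambda>j. \<Sum>n=1..N. x n * hankel_column \<theta> n j)"

definition hankel_well_defined ::
    "(nat \<Rightarrow> nat \<Rightarrow> real) \<Rightarrow> (nat \<Rightarrow> nat \<Rightarrow> real) \<Rightarrow>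
     (nat \<Rightarrow> 'a::{real_normed_field, banach}) \<Rightarrow> bool" where
  "hankel_well_defined a b \<theta> \<longleftrightarrow>
     (\<forall>n\<ge>1. hankel_column \<theta> n \<in> kothe_space b) \<and>
     (\<forall>x\<in>kothe_space a. \<exists>y.
        limitin (kothe_topology b) (hankel_partial_sum \<theta> x) y sequentially)"

text \<open>The sum of the series in \<open>K(b)\<close>; it is unique because the topology of a Koethe
  space is Hausdorff, see \<open>Hausdorff_kothe_topology\<close> below.\<close>

definition hankel_operator ::
    "(nat \<Rightarrow> nat \<Rightarrow> real) \<Rightarrow> (nat \<Rightarrow> 'a::{real_normed_field, banach}) \<Rightarrow>
     (nat \<Rightarrow> 'a) \<Rightarrow> (nat \<Rightarrow> 'a)" where
  "hankel_operator b \<theta> x =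
     (THE y. limitin (kothe_topology b) (hankel_partial_sum \<theta> x) y sequentially)"

lemma topspace_kothe_topology [simp]:
  "topspace (kothe_topology a :: (nat \<Rightarrow> 'a::{real_normed_field, banach}) topology) = kothe_space a"
proof -
  have "x \<in> kothe_ball a 1 x 1" if "x \<in> kothe_space a" for x :: "nat \<Rightarrow> 'a"
    using that by (simp add: kothe_ball_def kothe_seminorm_def)
  moreover have "kothe_ball a k x \<epsilon> \<subseteq> kothe_space a" for k \<epsilon> and x :: "nat \<Rightarrow> 'a"
    by (auto simp: kothe_ball_def)
  ultimately show ?thesis
    unfolding kothe_topology_def topology_generated_by_topspace
    by (intro equalityI subsetI) (blast, use le_refl zero_less_one in blast)
qed

lemma Hausdorff_kothe_topology:
  assumes a: "kothe_matrix a"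
  shows "Hausdorff_space (kothe_topology a :: (nat \<Rightarrow> 'a::{real_normed_field, banach}) topology)"
  unfolding Hausdorff_space_def topspace_kothe_topology
proof (intro allI impI, elim conjE)
  fix x y :: "nat \<Rightarrow> 'a"
  assume x: "x \<in> kothe_space a" and y: "y \<in> kothe_space a" and "x \<noteq> y"
  then obtain n where n: "x n \<noteq> y n" by blast
  with x y have n1: "n \<ge> 1" by (cases n) (auto simp: kothe_space_def)
  with a obtain k where k: "k \<ge> 1" "0 < a n k" by (auto simp: kothe_matrix_def)
  define d where "d = norm (x n - y n) * a n k"
  have d: "d > 0" using n k by (simp add: d_def)
  have nonneg: "0 \<le> a i k" if "i \<in> {1..}" for i
    using a k that by (auto simp: kothe_matrix_def)
  have bound: "norm (z n - w n) * a n k \<le> kothe_seminorm a k (\<lambda>i. z i - w i)"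
    if "z \<in> kothe_space a" "w \<in> kothe_space a" for z w :: "nat \<Rightarrow> 'a"
  proof -
    have "(\<lambda>i. norm (z i) * a i k + norm (w i) * a i k) summable_on {1..}"
      using that k by (intro summable_on_add) (auto simp: kothe_space_def)
    then have s: "(\<lambda>i. norm (z i - w i) * a i k) summable_on {1..}"
    proof (rule summable_on_comparison_test)
      fix i :: nat assume i: "i \<in> {1..}"
      show "norm (z i - w i) * a i k \<le> norm (z i) * a i k + norm (w i) * a i k"
        using mult_right_mono[OF norm_triangle_ineq4[of "z i" "w i"] nonneg[OF i]] by (simp add: algebra_simps)
    qed (use nonneg in auto)
    have "(\<Sum>\<^sub>\<infinity>i\<in>{n}. norm (z i - w i) * a i k) \<le> kothe_seminorm a k (\<lambda>i. z i - w i)"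
      unfolding kothe_seminorm_def
      using s n1 nonneg by (intro infsum_mono_neutral) (auto intro: summable_on_finite)
    then show ?thesis by simp
  qed
  have "disjnt (kothe_ball a k x (d / 2)) (kothe_ball a k y (d / 2))"
  proof (rule ccontr)
    assume "\<not> ?thesis"
    then obtain z where z: "z \<in> kothe_space a"
      "kothe_seminorm a k (\<lambda>i. z i - x i) < d / 2" "kothe_seminorm a k (\<lambda>i. z i - y i) < d / 2"
      by (auto simp: disjnt_iff kothe_ball_def)
    have "d \<le> (norm (z n - x n) + norm (z n - y n)) * a n k"
      unfolding d_def using k norm_triangle_ineq4[of "z n - y n" "z n - x n"]
      by (intro mult_right_mono) (auto simp: add.commute)
    with bound[OF z(1) x] bound[OF z(1) y] z show False by (simp add: algebra_simps)
  qed
  moreover have "openin (kothe_topology a) (kothe_ball a k w (d / 2))"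
    if "w \<in> kothe_space a" for w :: "nat \<Rightarrow> 'a"
    unfolding kothe_topology_def
  proof (rule topology_generated_by_Basis)
    have "0 < d / 2" using d by simp
    then show "kothe_ball a k w (d / 2) \<in>
        {kothe_ball a k x \<epsilon> | k x \<epsilon>. 1 \<le> k \<and> x \<in> kothe_space a \<and> 0 < \<epsilon>}"
      using that k by blast
  qed
  moreover have "w \<in> kothe_ball a k w (d / 2)"
    if "w \<in> kothe_space a" for w :: "nat \<Rightarrow> 'a"
    using that d by (simp add: kothe_ball_def kothe_seminorm_def)
  ultimately show "\<exists>U V. openin (kothe_topology a) U \<and> openin (kothe_topology a) V \<and>
      x \<in> U \<and> y \<in> V \<and> disjnt U V"
    using x y by blast
qed

end

theory Submission
  imports Defs
begin

text \<open>The columns of the Hankel matrix satisfy \<open>\<parallel>H e\<^sub>n\<parallel>\<^sub>k \<le> exp (\<beta>\<^sub>n / k) \<parallel>\<theta>\<parallel>\<^sub>l\<close> for \<open>l \<ge> k M\<close>: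
  by monotonicity and stability \<open>\<beta>\<^bsub>j+n-1\<^esub> \<le> M max(\<beta>\<^sub>j, \<beta>\<^sub>n) \<le> M (\<beta>\<^sub>j + \<beta>\<^sub>n)\<close>, whence
  \<open>exp (- \<beta>\<^sub>j / k) \<le> exp (\<beta>\<^sub>n / k) exp (- \<beta>\<^bsub>j+n-1\<^esub> / l)\<close>.  With the hypothesis on \<open>a\<close> this gives
  \<open>\<parallel>H e\<^sub>n\<parallel>\<^sub>k \<le> C a\<^bsub>n,m\<^esub>\<close>.  For any matrix whose columns obey such estimates, the series
  \<open>\<Sum> x\<^sub>n H e\<^sub>n\<close> converges absolutely in every seminorm and its sum is bounded by \<open>C \<parallel>x\<parallel>\<^sub>m\<close>.\<close>

section \<open>Koethe seminorms and the Koethe topology\<close>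

lemma kothe_matrix_nonneg:
  assumes "kothe_matrix a" "n \<ge> 1" "k \<ge> 1"
  shows "0 \<le> a n k"
  using assms by (auto simp: kothe_matrix_def)

lemma kothe_space_summable:
  assumes "x \<in> kothe_space a" "k \<ge> 1"
  shows "(\<lambda>n. norm (x n) * a n k) summable_on {1..}"
  using assms by (auto simp: kothe_space_def)

text \<open>Puts truncations of an element of the space back into it. The domination includes index
  0, which forces the normalisation \<open>y 0 = 0\<close>.\<close>

lemma kothe_space_mono:
  assumes a: "kothe_matrix a" and x: "x \<in> kothe_space a"
    and le: "\<And>n. norm (y n) \<le> norm (x n)"
  shows "y \<in> kothe_space a"
proof -
  have "y 0 = 0"
    using le[of 0] x by (simp add: kothe_space_def)
  moreover have "(\<lambda>n. norm (y n) * a n k) summable_on {1..}" if "k \<ge> 1" for k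
    by (rule summable_on_comparison_test[OF kothe_space_summable[OF x that]])
      (use kothe_matrix_nonneg[OF a] le that in \<open>auto intro!: mult_right_mono\<close>)
  ultimately show ?thesis by (simp add: kothe_space_def)
qed

lemma kothe_space_diff:
  assumes a: "kothe_matrix a" and x: "x \<in> kothe_space a" and y: "y \<in> kothe_space a"
  shows "(\<lambda>n. x n - y n) \<in> kothe_space a"
proof -
  have "(\<lambda>n. norm (x n - y n) * a n k) summable_on {1..}" if "k \<ge> 1" for k
  proof (rule summable_on_comparison_test)
    show "(\<lambda>n. norm (x n) * a n k + norm (y n) * a n k) summable_on {1..}"
      by (intro summable_on_add kothe_space_summable x y that)
    show "norm (x n - y n) * a n k \<le> norm (x n) * a n k + norm (y n) * a n k" if "n \<in> {1..}" for n
      using mult_right_mono[OF norm_triangle_ineq4[of "x n" "y n"] kothe_matrix_nonneg[OF a, of n k]]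
        that \<open>k \<ge> 1\<close> by (simp add: algebra_simps)
  qed (use kothe_matrix_nonneg[OF a] that in auto)
  with x y show ?thesis by (simp add: kothe_space_def)
qed

lemma kothe_seminorm_triangle:
  assumes a: "kothe_matrix a" and k: "k \<ge> 1"
    and x: "x \<in> kothe_space a" and y: "y \<in> kothe_space a" and z: "z \<in> kothe_space a"
  shows "kothe_seminorm a k (\<lambda>n. x n - z n) \<le>
    kothe_seminorm a k (\<lambda>n. x n - y n) + kothe_seminorm a k (\<lambda>n. y n - z n)"
proof -
  note s = kothe_space_summable[OF kothe_space_diff[OF a] k]
  have "kothe_seminorm a k (\<lambda>n. x n - z n) \<le>
      (\<Sum>\<^sub>\<infinity>n\<in>{1..}. norm (x n - y n) * a n k + norm (y n - z n) * a n k)"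
    unfolding kothe_seminorm_def
  proof (rule infsum_mono)
    show "norm (x n - z n) * a n k \<le> norm (x n - y n) * a n k + norm (y n - z n) * a n k"
      if "n \<in> {1..}" for n
      using mult_right_mono[OF norm_triangle_ineq[of "x n - y n" "y n - z n"]
          kothe_matrix_nonneg[OF a, of n k]] that k
      by (simp add: algebra_simps)
  qed (intro summable_on_add s x y z)+
  also have "\<dots> = kothe_seminorm a k (\<lambda>n. x n - y n) + kothe_seminorm a k (\<lambda>n. y n - z n)"
    unfolding kothe_seminorm_def by (intro infsum_add s x y z)
  finally show ?thesis .
qed

text \<open>The segments \<open>{1..N}\<close> are cofinal among the finite subsets of
  \<open>{1..}\<close>, so ordinary partial sums converge to the unordered sum; the seminorm of the
  tail is the remainder.\<close>

lemma kothe_seminorm_tail: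
  assumes x: "x \<in> kothe_space a" and k: "k \<ge> 1"
  shows "(\<lambda>N. kothe_seminorm a k (\<lambda>n. if n \<le> N then 0 else x n)) \<longlonglongrightarrow> 0"
proof -
  define f where "f n = norm (x n) * a n k" for n
  have f: "f summable_on {1..}"
    unfolding f_def using kothe_space_summable[OF x k] .
  have "filterlim (\<lambda>N. {1..N}) (finite_subsets_at_top {1..}) sequentially"
    unfolding filterlim_finite_subsets_at_top
  proof (intro allI impI)
    fix X :: "nat set" assume X: "finite X \<and> X \<subseteq> {1..}"
    \<comment> \<open>Inserting 0 keeps \<open>Max\<close> meaningful for empty
      \<open>X\<close>.\<close>
    then have "X \<subseteq> {1..N}" if "N \<ge> Max (insert 0 X)" for N
      using that by (auto simp: Max_ge_iff)
    then show "\<forall>\<^sub>F N in sequentially. finite {1..N} \<and> X \<subseteq> {1..N} \<and> {1..N} \<subseteq> {1..}"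
      by (auto simp: eventually_sequentially intro!: exI[of _ "Max (insert 0 X)"])
  qed
  then have "(\<lambda>N. sum f {1..N}) \<longlonglongrightarrow> infsum f {1..}"
    using has_sum_infsum[OF f] unfolding has_sum_def by (rule filterlim_compose[rotated])
  then have "(\<lambda>N. infsum f {1..} - sum f {1..N}) \<longlonglongrightarrow> infsum f {1..} - infsum f {1..}"
    by (intro tendsto_intros)
  moreover have "infsum f {1..} - sum f {1..N} = kothe_seminorm a k (\<lambda>n. if n \<le> N then 0 else x n)"
    for N
  proof -
    have "infsum f {1..} - infsum f {1..N} = infsum f ({1..} - {1..N})"
      by (rule infsum_Diff[symmetric]) (use f in auto)
    also have "\<dots> = kothe_seminorm a k (\<lambda>n. if n \<le> N then 0 else x n)"
      unfolding kothe_seminorm_def by (intro infsum_cong_neutral) (auto simp: f_def)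
    finally show ?thesis by simp
  qed
  ultimately show ?thesis by simp
qed

section \<open>Convergence and continuity from seminorm estimates\<close>

lemma openin_kothe_ball:
  assumes "k \<ge> 1" "x \<in> kothe_space a" "\<epsilon> > 0"
  shows "openin (kothe_topology a) (kothe_ball a k x \<epsilon>)"
  unfolding kothe_topology_def by (rule topology_generated_by_Basis) (use assms in blast)

lemma Union_kothe_balls:
  "\<Union>{kothe_ball a k x \<epsilon> | k x \<epsilon>. 1 \<le> k \<and> x \<in> kothe_space a \<and> 0 < \<epsilon>} =
    (kothe_space a :: (nat \<Rightarrow> 'a::{real_normed_field, banach}) set)"
  using topspace_kothe_topology[of a, where 'a = 'a]
  unfolding kothe_topology_def topology_generated_by_topspace .

text \<open>A subbase suffices: the property of eventually containing \<open>f n\<close> passes to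
  finite intersections and to unions, hence by induction to every generated open set around
  \<open>l\<close>.\<close>

lemma limitin_topology_generated_by:
  assumes l: "l \<in> \<Union>S" and ev: "\<And>U. U \<in> S \<Longrightarrow> l \<in> U \<Longrightarrow> \<forall>\<^sub>F n in F. f n \<in> U"
  shows "limitin (topology_generated_by S) f l F"
proof -
  have "l \<in> U \<longrightarrow> (\<forall>\<^sub>F n in F. f n \<in> U)" if "generate_topology_on S U" for U
    using that
  proof induction
    case (UN K)
    then show ?case by (blast intro: eventually_mono)
  qed (auto simp: eventually_conj_iff ev)
  with l show ?thesis
    by (auto simp: limitin_def topology_generated_by_topspace openin_topology_generated_by_iff)
qed

text \<open>Subbasic balls containing \<open>l\<close> need not be centred at \<open>l\<close>. The
  triangle inequality leaves the slack \<epsilon> minus the distance from \<open>l\<close> to the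
  centre, and the convergence hypothesis beats this slack.\<close>

lemma limitin_kothe_topologyI:
  assumes a: "kothe_matrix a" and l: "l \<in> kothe_space a" and f: "\<And>n. f n \<in> kothe_space a"
    and lim: "\<And>k. k \<ge> 1 \<Longrightarrow> ((\<lambda>n. kothe_seminorm a k (\<lambda>i. f n i - l i)) \<longlongrightarrow> 0) F"
  shows "limitin (kothe_topology a) f l F"
  unfolding kothe_topology_def
proof (rule limitin_topology_generated_by)
  show "l \<in> \<Union>{kothe_ball a k x \<epsilon> | k x \<epsilon>. 1 \<le> k \<and> x \<in> kothe_space a \<and> 0 < \<epsilon>}"
    unfolding Union_kothe_balls using l .
next
  fix U assume "U \<in> {kothe_ball a k x \<epsilon> | k x \<epsilon>. 1 \<le> k \<and> x \<in> kothe_space a \<and> 0 < \<epsilon>}" "l \<in> U"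
  then obtain k x \<epsilon> where k: "1 \<le> k" and x: "x \<in> kothe_space a" and U: "U = kothe_ball a k x \<epsilon>"
    and l\<epsilon>: "0 < \<epsilon> - kothe_seminorm a k (\<lambda>i. l i - x i)"
    by (auto simp: kothe_ball_def)
  from order_tendstoD(2)[OF lim[OF k] l\<epsilon>]
  show "\<forall>\<^sub>F n in F. f n \<in> U"
  proof eventually_elim
    case (elim n)
    with kothe_seminorm_triangle[OF a k f[of n] l x] f[of n] show ?case
      by (simp add: U kothe_ball_def)
  qed
qed

text \<open>Stating the estimate for differences \<open>T x - T y\<close> combines linearity and
  boundedness in one Lipschitz condition.\<close>

lemma continuous_map_kothe_topologyI:
  fixes T :: "(nat \<Rightarrow> 'a::{real_normed_field, banach}) \<Rightarrow> nat \<Rightarrow> 'b::{real_normed_field, banach}"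
  assumes a: "kothe_matrix a" and b: "kothe_matrix b"
    and T: "\<And>x. x \<in> kothe_space a \<Longrightarrow> T x \<in> kothe_space b"
    and bound: "\<And>k. k \<ge> 1 \<Longrightarrow> \<exists>m\<ge>1. \<exists>C>0. \<forall>x\<in>kothe_space a. \<forall>y\<in>kothe_space a.
      kothe_seminorm b k (\<lambda>j. T x j - T y j) \<le> C * kothe_seminorm a m (\<lambda>n. x n - y n)"
  shows "continuous_map (kothe_topology a) (kothe_topology b) T"
  unfolding kothe_topology_def[of b]
proof (rule continuous_on_generated_topo)
  show "T ` topspace (kothe_topology a) \<subseteq>
      \<Union>{kothe_ball b k x \<epsilon> | k x \<epsilon>. 1 \<le> k \<and> x \<in> kothe_space b \<and> 0 < \<epsilon>}"
    unfolding Union_kothe_balls using T by auto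
next
  fix U :: "(nat \<Rightarrow> 'b) set"
  assume "U \<in> {kothe_ball b k x \<epsilon> | k x \<epsilon>. 1 \<le> k \<and> x \<in> kothe_space b \<and> 0 < \<epsilon>}"
  then obtain k z \<epsilon> where k: "1 \<le> k" and z: "z \<in> kothe_space b" and U: "U = kothe_ball b k z \<epsilon>"
    by auto
  obtain m C where m: "m \<ge> 1" and C: "C > 0" and mC:
    "\<And>x y. x \<in> kothe_space a \<Longrightarrow> y \<in> kothe_space a \<Longrightarrow>
      kothe_seminorm b k (\<lambda>j. T x j - T y j) \<le> C * kothe_seminorm a m (\<lambda>n. x n - y n)"
    using bound[OF k] by blast
  show "openin (kothe_topology a) (T -` U \<inter> topspace (kothe_topology a))"
  proof (subst openin_subopen, intro ballI)
    fix x assume "x \<in> T -` U \<inter> topspace (kothe_topology a)"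
    then have x: "x \<in> kothe_space a" and Tx: "T x \<in> U" by auto
    \<comment> \<open>The slack of \<open>T x\<close> inside the ball around \<open>z\<close>,
      divided by the Lipschitz constant \<open>C\<close>.\<close>
    define \<delta> where "\<delta> = (\<epsilon> - kothe_seminorm b k (\<lambda>j. T x j - z j)) / C"
    have \<delta>: "\<delta> > 0"
      using Tx C by (simp add: U kothe_ball_def \<delta>_def)
    have "kothe_ball a m x \<delta> \<subseteq> T -` U \<inter> topspace (kothe_topology a)"
    proof
      fix y assume "y \<in> kothe_ball a m x \<delta>"
      then have y: "y \<in> kothe_space a" and yx: "kothe_seminorm a m (\<lambda>n. y n - x n) < \<delta>"
        by (auto simp: kothe_ball_def)
      have "kothe_seminorm b k (\<lambda>j. T y j - T x j) < C * \<delta>"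
        using mC[OF y x] mult_strict_left_mono[OF yx C] by linarith
      also have "C * \<delta> = \<epsilon> - kothe_seminorm b k (\<lambda>j. T x j - z j)"
        using C by (simp add: \<delta>_def)
      finally show "y \<in> T -` U \<inter> topspace (kothe_topology a)"
        using kothe_seminorm_triangle[OF b k T[OF y] T[OF x] z] y T[OF y]
        by (simp add: U kothe_ball_def)
    qed
    moreover have "x \<in> kothe_ball a m x \<delta>"
      using x \<delta> by (simp add: kothe_ball_def kothe_seminorm_def)
    ultimately show "\<exists>V. openin (kothe_topology a) V \<and> x \<in> V \<and>
        V \<subseteq> T -` U \<inter> topspace (kothe_topology a)"
      using openin_kothe_ball[OF m x \<delta>] by blast
  qed
qed

section \<open>Matrices with bounded columns\<close>

text \<open>Here \<open>h n\<close> plays the role of the image of the \<open>n\<close>-th unit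
  sequence. The last assumption is the continuity estimate tested on unit sequences, which is enough
  for weighted l1 spaces.\<close>

locale kothe_columns =
  fixes a b :: "nat \<Rightarrow> nat \<Rightarrow> real" and h :: "nat \<Rightarrow> nat \<Rightarrow> 'a::{real_normed_field, banach}"
  assumes a: "kothe_matrix a" and b: "kothe_matrix b"
    and column_in: "n \<ge> 1 \<Longrightarrow> h n \<in> kothe_space b"
    and column_bound: "k \<ge> 1 \<Longrightarrow> \<exists>m\<ge>1. \<exists>C>0. \<forall>n\<ge>1. kothe_seminorm b k (h n) \<le> C * a n m"
begin

text \<open>The operator is defined coordinatewise, as an unordered scalar sum, so that linearity
  and estimates precede any topological limit. \<open>column_sum_abs_summable\<close> shows that on
  \<open>kothe_space a\<close> this is never the default value 0 of a divergent
  \<open>infsum\<close>.\<close>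

definition column_sum :: "(nat \<Rightarrow> 'a) \<Rightarrow> nat \<Rightarrow> 'a" where
  "column_sum x j = (\<Sum>\<^sub>\<infinity>n\<in>{1..}. x n * h n j)"

text \<open>Summing over \<open>j\<close> first turns the family into norm (x n) times the seminorm
  of \<open>h n\<close>, which is dominated by \<open>C * (norm (x n) * a n m)\<close>. This
  licenses the exchange of sums below.\<close>

lemma column_sum_double_summable:
  assumes x: "x \<in> kothe_space a" and k: "k \<ge> 1" and m: "m \<ge> 1"
    and C: "\<And>n. n \<ge> 1 \<Longrightarrow> kothe_seminorm b k (h n) \<le> C * a n m"
  shows "(\<lambda>(n, j). norm (x n) * (norm (h n j) * b j k)) summable_on {1..} \<times> {1..}"
proof (rule summable_on_SigmaI)
  show "((\<lambda>j. case (n, j) of (n, j) \<Rightarrow> norm (x n) * (norm (h n j) * b j k)) has_sum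
      norm (x n) * kothe_seminorm b k (h n)) {1..}" if "n \<in> {1..}" for n
    unfolding prod.case kothe_seminorm_def
    by (intro has_sum_cmult_right has_sum_infsum kothe_space_summable column_in)
      (use k that in auto)
  show "(\<lambda>n. norm (x n) * kothe_seminorm b k (h n)) summable_on {1..}"
  proof (rule summable_on_comparison_test)
    show "(\<lambda>n. C * (norm (x n) * a n m)) summable_on {1..}"
      by (intro summable_on_cmult_right kothe_space_summable x m)
    show "norm (x n) * kothe_seminorm b k (h n) \<le> C * (norm (x n) * a n m)" if "n \<in> {1..}" for n
      using mult_left_mono[OF C, of n "norm (x n)"] that by (simp add: mult_ac)
    show "0 \<le> norm (x n) * kothe_seminorm b k (h n)" for n
      unfolding kothe_seminorm_def
      by (intro mult_nonneg_nonneg infsum_nonneg) (use kothe_matrix_nonneg[OF b] k in auto)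
  qed
qed (use kothe_matrix_nonneg[OF b] k in auto)

text \<open>For j \<ge> 1 some weight \<open>b j k\<close> is positive; fix the row \<open>j\<close>
  of the double family and divide by that weight. At index 0 all columns vanish.\<close>

lemma column_sum_abs_summable:
  assumes x: "x \<in> kothe_space a"
  shows "(\<lambda>n. x n * h n j) abs_summable_on {1..}"
proof (cases "j = 0")
  case True
  show ?thesis
    by (rule summable_on_0) (use True column_in in \<open>auto simp: kothe_space_def\<close>)
next
  case False
  then have "j \<ge> 1" by simp
  then obtain k where k: "k \<ge> 1" and pos: "b j k > 0"
    using b unfolding kothe_matrix_def by blast
  obtain m C where m: "m \<ge> 1" and C: "\<And>n. n \<ge> 1 \<Longrightarrow> kothe_seminorm b k (h n) \<le> C * a n m"
    using column_bound[OF k] by blast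
  have "(\<lambda>(j, n). norm (x n) * (norm (h n j) * b j k)) summable_on {1..} \<times> {1..}"
    using column_sum_double_summable[OF x k m C] by (subst summable_on_swap) auto
  then have "(\<lambda>n. norm (x n) * (norm (h n j) * b j k)) summable_on {1..}"
    using False by (auto dest: summable_on_SigmaD1[where x = j])
  then have "(\<lambda>n. norm (x n) * (norm (h n j) * b j k) * inverse (b j k)) summable_on {1..}"
    by (rule summable_on_cmult_left)
  with pos show ?thesis by (simp add: norm_mult mult.assoc)
qed

text \<open>Triangle inequality inside each coordinate, then Fubini, then the column estimate. The
  same \<open>m\<close> and \<open>C\<close> work for every \<open>x\<close>.\<close>

lemma column_sum_bound:
  assumes x: "x \<in> kothe_space a" and k: "k \<ge> 1" and m: "m \<ge> 1"
    and C: "\<And>n. n \<ge> 1 \<Longrightarrow> kothe_seminorm b k (h n) \<le> C * a n m"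
  shows "(\<lambda>j. norm (column_sum x j) * b j k) summable_on {1..}"
    and "kothe_seminorm b k (column_sum x) \<le> C * kothe_seminorm a m x"
proof -
  let ?G = "\<lambda>n j. norm (x n) * (norm (h n j) * b j k)"
  note dbl = column_sum_double_summable[OF x k m C]
  have dbl': "(\<lambda>(j, n). ?G n j) summable_on {1..} \<times> {1..}"
    using dbl by (subst summable_on_swap) auto
  have outer: "(\<lambda>j. \<Sum>\<^sub>\<infinity>n\<in>{1..}. ?G n j) summable_on {1..}"
    using summable_on_Sigma_banach[OF dbl'] by simp
  have pointwise: "norm (column_sum x j) * b j k \<le> (\<Sum>\<^sub>\<infinity>n\<in>{1..}. ?G n j)" if "j \<in> {1..}" for j
  proof -
    have "norm (column_sum x j) * b j k \<le> (\<Sum>\<^sub>\<infinity>n\<in>{1..}. norm (x n * h n j)) * b j k"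
      unfolding column_sum_def
      by (intro mult_right_mono norm_infsum_bound column_sum_abs_summable[OF x])
        (use kothe_matrix_nonneg[OF b] k that in auto)
    also have "\<dots> = (\<Sum>\<^sub>\<infinity>n\<in>{1..}. ?G n j)"
      by (simp add: infsum_cmult_left'[symmetric] norm_mult mult.assoc)
    finally show ?thesis .
  qed
  show summable: "(\<lambda>j. norm (column_sum x j) * b j k) summable_on {1..}"
    by (rule summable_on_comparison_test[OF outer pointwise])
      (use kothe_matrix_nonneg[OF b] k in auto)
  have "kothe_seminorm b k (column_sum x) \<le> (\<Sum>\<^sub>\<infinity>j\<in>{1..}. \<Sum>\<^sub>\<infinity>n\<in>{1..}. ?G n j)"
    unfolding kothe_seminorm_def by (rule infsum_mono[OF summable outer pointwise])
  also have "\<dots> = (\<Sum>\<^sub>\<infinity>n\<in>{1..}. \<Sum>\<^sub>\<infinity>j\<in>{1..}. ?G n j)"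
    by (rule infsum_swap_banach[symmetric, OF dbl])
  also have "\<dots> \<le> (\<Sum>\<^sub>\<infinity>n\<in>{1..}. C * (norm (x n) * a n m))"
  proof (rule infsum_mono)
    show "(\<lambda>n. \<Sum>\<^sub>\<infinity>j\<in>{1..}. ?G n j) summable_on {1..}"
      using summable_on_Sigma_banach[OF dbl] by simp
    show "(\<lambda>n. C * (norm (x n) * a n m)) summable_on {1..}"
      by (intro summable_on_cmult_right kothe_space_summable x m)
    show "(\<Sum>\<^sub>\<infinity>j\<in>{1..}. ?G n j) \<le> C * (norm (x n) * a n m)" if "n \<in> {1..}" for n
      using mult_left_mono[OF C, of n "norm (x n)"] that
      by (simp add: infsum_cmult_right' kothe_seminorm_def mult_ac)
  qed
  also have "\<dots> = C * kothe_seminorm a m x"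
    by (simp add: infsum_cmult_right' kothe_seminorm_def)
  finally show "kothe_seminorm b k (column_sum x) \<le> C * kothe_seminorm a m x" .
qed

lemma column_sum_in_kothe_space:
  assumes x: "x \<in> kothe_space a"
  shows "column_sum x \<in> kothe_space b"
proof -
  have "column_sum x 0 = 0"
    unfolding column_sum_def
    by (rule infsum_0) (use column_in in \<open>auto simp: kothe_space_def\<close>)
  moreover have "(\<lambda>j. norm (column_sum x j) * b j k) summable_on {1..}" if k: "k \<ge> 1" for k
    using column_bound[OF k] column_sum_bound(1)[OF x k] by blast
  ultimately show ?thesis by (simp add: kothe_space_def)
qed

lemma column_sum_diff:
  assumes "x \<in> kothe_space a" "y \<in> kothe_space a"
  shows "column_sum x j - column_sum y j = column_sum (\<lambda>n. x n - y n) j"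
proof -
  note summable = column_sum_abs_summable[THEN abs_summable_summable]
  have "column_sum (\<lambda>n. x n - y n) j + column_sum y j =
      (\<Sum>\<^sub>\<infinity>n\<in>{1..}. (x n - y n) * h n j + y n * h n j)"
    unfolding column_sum_def
    by (rule infsum_add[symmetric, OF summable[OF kothe_space_diff[OF a assms]] summable[OF assms(2)]])
  then show ?thesis
    by (simp add: column_sum_def diff_eq_eq flip: distrib_right)
qed

lemma column_sum_diff_bound:
  assumes "k \<ge> 1"
  shows "\<exists>m\<ge>1. \<exists>C>0. \<forall>x\<in>kothe_space a. \<forall>y\<in>kothe_space a.
    kothe_seminorm b k (\<lambda>j. column_sum x j - column_sum y j) \<le>
      C * kothe_seminorm a m (\<lambda>n. x n - y n)"
proof -
  obtain m C where m: "m \<ge> 1" "C > 0"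
    and C: "\<And>n. n \<ge> 1 \<Longrightarrow> kothe_seminorm b k (h n) \<le> C * a n m"
    using column_bound[OF assms] by blast
  have "kothe_seminorm b k (\<lambda>j. column_sum x j - column_sum y j) \<le>
      C * kothe_seminorm a m (\<lambda>n. x n - y n)"
    if "x \<in> kothe_space a" "y \<in> kothe_space a" for x y
    using column_sum_bound(2)[OF kothe_space_diff[OF a that] assms m(1) C]
    by (simp add: column_sum_diff[OF that])
  with m show ?thesis by blast
qed

lemma continuous_map_column_sum:
  "continuous_map (kothe_topology a) (kothe_topology b) column_sum"
  by (intro continuous_map_kothe_topologyI a b column_sum_in_kothe_space column_sum_diff_bound)

text \<open>A partial sum is the column sum of the truncation \<open>t N\<close>. The Lipschitz
  estimate therefore bounds the error by a tail seminorm of \<open>x\<close> in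
  \<open>kothe_space a\<close>, which tends to 0.\<close>

lemma limitin_partial_sums:
  assumes x: "x \<in> kothe_space a"
  shows "limitin (kothe_topology b) (\<lambda>N j. \<Sum>n=1..N. x n * h n j) (column_sum x) sequentially"
proof -
  define t where "t N n = (if n \<le> N then x n else 0)" for N n
  have t: "t N \<in> kothe_space a" for N
    by (rule kothe_space_mono[OF a x]) (simp add: t_def)
  have partial: "column_sum (t N) = (\<lambda>j. \<Sum>n=1..N. x n * h n j)" for N
  proof
    fix j
    have "column_sum (t N) j = (\<Sum>\<^sub>\<infinity>n\<in>{1..N}. x n * h n j)"
      unfolding column_sum_def by (intro infsum_cong_neutral) (auto simp: t_def)
    then show "column_sum (t N) j = (\<Sum>n=1..N. x n * h n j)" by simp
  qed
  have tail: "kothe_seminorm a m (\<lambda>n. t N n - x n) =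
      kothe_seminorm a m (\<lambda>n. if n \<le> N then 0 else x n)" for m N
    unfolding kothe_seminorm_def by (intro infsum_cong) (simp add: t_def)
  have "limitin (kothe_topology b) (\<lambda>N. column_sum (t N)) (column_sum x) sequentially"
  proof (rule limitin_kothe_topologyI[OF b])
    fix k :: nat assume k: "k \<ge> 1"
    obtain m C where m: "m \<ge> 1" and mC: "\<And>x y. x \<in> kothe_space a \<Longrightarrow> y \<in> kothe_space a \<Longrightarrow>
        kothe_seminorm b k (\<lambda>j. column_sum x j - column_sum y j) \<le>
          C * kothe_seminorm a m (\<lambda>n. x n - y n)"
      using column_sum_diff_bound[OF k] by blast
    show "(\<lambda>N. kothe_seminorm b k (\<lambda>j. column_sum (t N) j - column_sum x j)) \<longlonglongrightarrow> 0"
    proof (rule tendsto_sandwich[OF _ _ tendsto_const])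
      show "(\<lambda>N. C * kothe_seminorm a m (\<lambda>n. if n \<le> N then 0 else x n)) \<longlonglongrightarrow> 0"
        using tendsto_mult_left[OF kothe_seminorm_tail[OF x m], of C] by simp
      show "\<forall>\<^sub>F N in sequentially. kothe_seminorm b k (\<lambda>j. column_sum (t N) j - column_sum x j) \<le>
          C * kothe_seminorm a m (\<lambda>n. if n \<le> N then 0 else x n)"
        using mC[OF t x] by (simp add: tail)
      show "\<forall>\<^sub>F N in sequentially.
          0 \<le> kothe_seminorm b k (\<lambda>j. column_sum (t N) j - column_sum x j)"
        unfolding kothe_seminorm_def
        by (intro always_eventually allI infsum_nonneg mult_nonneg_nonneg)
          (use kothe_matrix_nonneg[OF b] k in auto)
    qed
  qed (intro column_sum_in_kothe_space t x)+
  then show ?thesis by (simp only: partial)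
qed

end

section \<open>Hankel columns in power series spaces of finite type\<close>

lemma kothe_matrix_power_series_matrix:
  assumes "\<forall>n\<ge>1. 0 \<le> \<beta> n"
  shows "kothe_matrix (power_series_matrix \<beta>)"
proof -
  have "\<beta> n / (real k + 1) \<le> \<beta> n / real k" if "n \<ge> 1" "k \<ge> 1" for n k
    using assms that by (intro divide_left_mono) auto
  then show ?thesis
    by (auto simp: kothe_matrix_def power_series_matrix_def add.commute)
qed

text \<open>The index \<open>j + n - 1\<close> is at most twice the larger of \<open>j\<close> and
  \<open>n\<close>. The constant is made a natural number because it later multiplies a seminorm
  index.\<close>

lemma stable_seq_add_le:
  assumes nonneg: "\<forall>n\<ge>1. 0 \<le> \<beta> n" and mono: "mono_on {1..} \<beta>" and "stable_seq \<beta>"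
  obtains M :: nat where "M \<ge> 1"
    "\<And>n j. n \<ge> 1 \<Longrightarrow> j \<ge> 1 \<Longrightarrow> \<beta> (j + n - 1) \<le> real M * (\<beta> j + \<beta> n)"
proof -
  obtain M\<^sub>0 where M\<^sub>0: "\<And>n. n \<ge> 1 \<Longrightarrow> \<beta> (2 * n) \<le> M\<^sub>0 * \<beta> n"
    using assms by (auto simp: stable_seq_def)
  obtain M where M: "M\<^sub>0 \<le> real M" using real_arch_simple by blast
  show thesis
  \<comment> \<open>The successor makes the constant at least 1.\<close>
  proof (rule that[of "Suc M"])
    fix n j :: nat assume n: "n \<ge> 1" and j: "j \<ge> 1"
    have nonneg': "0 \<le> \<beta> n" "0 \<le> \<beta> j" using nonneg n j by auto
    have "\<beta> (j + n - 1) \<le> \<beta> (2 * max j n)"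
      by (rule mono_onD[OF mono]) (use n j in auto)
    also have "\<dots> \<le> M\<^sub>0 * \<beta> (max j n)" using M\<^sub>0 n by simp
    also have "\<dots> \<le> real (Suc M) * \<beta> (max j n)"
      by (rule mult_right_mono) (use M nonneg' in \<open>auto simp: max_def\<close>)
    also have "\<dots> \<le> real (Suc M) * (\<beta> j + \<beta> n)"
      by (rule mult_left_mono) (use nonneg' in \<open>auto simp: max_def\<close>)
    finally show "\<beta> (j + n - 1) \<le> real (Suc M) * (\<beta> j + \<beta> n)" .
  qed simp
qed

text \<open>Summability accompanies the estimate because \<open>kothe_seminorm\<close> is 0 on a
  divergent series. \<open>S\<close> does not depend on \<open>n\<close>.\<close>

lemma hankel_column_bound:
  fixes \<theta> :: "nat \<Rightarrow> 'a::{real_normed_field, banach}"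
  assumes nonneg: "\<forall>n\<ge>1. 0 \<le> \<beta> n" and mono: "mono_on {1..} \<beta>" and stable: "stable_seq \<beta>"
    and \<theta>: "reindex \<theta> \<in> power_series_space \<beta>" and k: "k \<ge> 1"
  shows "\<exists>S>0. \<forall>n\<ge>1.
    (\<lambda>j. norm (hankel_column \<theta> n j) * power_series_matrix \<beta> j k) summable_on {1..} \<and>
    kothe_seminorm (power_series_matrix \<beta>) k (hankel_column \<theta> n) \<le> S * exp (1 / real k * \<beta> n)"
proof -
  obtain M :: nat where M: "M \<ge> 1"
    and le: "\<And>n j. n \<ge> 1 \<Longrightarrow> j \<ge> 1 \<Longrightarrow> \<beta> (j + n - 1) \<le> real M * (\<beta> j + \<beta> n)"
    using stable_seq_add_le[OF nonneg mono stable] by blast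
  \<comment> \<open>The seminorm index \<open>k * M\<close> absorbs the stability constant: dividing
    the bound on \<open>\<beta> (j + n - 1)\<close> by \<open>k * M\<close> leaves
    \<open>(\<beta> j + \<beta> n) / k\<close>.\<close>
  define f where "f i = norm (reindex \<theta> i) * power_series_matrix \<beta> i (k * M)" for i
  have f: "f summable_on {1..}"
    unfolding f_def using kothe_space_summable[OF \<theta>, of "k * M"] k M by simp
  have f0: "f i \<ge> 0" for i by (simp add: f_def power_series_matrix_def)
  have pointwise: "norm (hankel_column \<theta> n j) * power_series_matrix \<beta> j k \<le>
      f (j + n - 1) * exp (1 / real k * \<beta> n)" if n: "n \<ge> 1" and j: "j \<in> {1..}" for n j
  proof -
    have "- (1 / real k) * \<beta> j \<le> - (1 / real (k * M)) * \<beta> (j + n - 1) + 1 / real k * \<beta> n"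
      using le[OF n, of j] j k M by (simp add: field_simps)
    then have "power_series_matrix \<beta> j k \<le>
        power_series_matrix \<beta> (j + n - 1) (k * M) * exp (1 / real k * \<beta> n)"
      by (simp add: power_series_matrix_def flip: exp_add)
    \<comment> \<open>\<open>reindex\<close> shifts by one, so the entry of \<theta> at
      \<open>j + n - 2\<close> sits at position \<open>j + n - 1\<close>.\<close>
    moreover have "hankel_column \<theta> n j = reindex \<theta> (j + n - 1)"
      using n j by (simp add: hankel_column_def reindex_def numeral_2_eq_2)
    ultimately show ?thesis
      by (simp add: f_def mult.assoc mult_left_mono)
  qed
  have img: "(\<lambda>j. j + n - 1) ` {1..} \<subseteq> {1..}" and inj: "inj_on (\<lambda>j. j + n - 1) {1..}"
    if "n \<ge> 1" for n :: nat
    using that by (auto simp: inj_on_def)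
  \<comment> \<open>The index map is injective into \<open>{1..}\<close>, so the shifted sum runs
    over part of the nonnegative family \<open>f\<close>.\<close>
  have shift: "(\<lambda>j. f (j + n - 1)) summable_on {1..}"
    "(\<Sum>\<^sub>\<infinity>j\<in>{1..}. f (j + n - 1)) \<le> infsum f {1..}" if n: "n \<ge> 1" for n
  proof -
    have sub: "f summable_on (\<lambda>j. j + n - 1) ` {1..}"
      using summable_on_subset_banach[OF f img[OF n]] .
    then show "(\<lambda>j. f (j + n - 1)) summable_on {1..}"
      using summable_on_reindex[OF inj[OF n], of f] by (simp add: o_def)
    have "(\<Sum>\<^sub>\<infinity>j\<in>{1..}. f (j + n - 1)) = infsum f ((\<lambda>j. j + n - 1) ` {1..})"
      using infsum_reindex[OF inj[OF n], of f] by (simp add: o_def)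
    also have "\<dots> \<le> infsum f {1..}"
      by (rule infsum_mono2[OF sub f img[OF n]]) (rule f0)
    finally show "(\<Sum>\<^sub>\<infinity>j\<in>{1..}. f (j + n - 1)) \<le> infsum f {1..}" .
  qed
  have summable:
    "(\<lambda>j. norm (hankel_column \<theta> n j) * power_series_matrix \<beta> j k) summable_on {1..}"
    if n: "n \<ge> 1" for n
    by (rule summable_on_comparison_test[OF summable_on_cmult_left[OF shift(1)[OF n]] pointwise[OF n]])
      (auto simp: power_series_matrix_def)
  show ?thesis
  \<comment> \<open>Adding 1 keeps the constant positive even when \<theta> is zero.\<close>
  proof (intro exI[of _ "infsum f {1..} + 1"] conjI allI impI summable)
    show "infsum f {1..} + 1 > 0"
      using infsum_nonneg[of "{1..}" f] f0 by (simp add: add_nonneg_pos)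
  next
    fix n :: nat assume n: "n \<ge> 1"
    have "kothe_seminorm (power_series_matrix \<beta>) k (hankel_column \<theta> n) \<le>
        (\<Sum>\<^sub>\<infinity>j\<in>{1..}. f (j + n - 1) * exp (1 / real k * \<beta> n))"
      unfolding kothe_seminorm_def
      by (rule infsum_mono[OF summable[OF n] summable_on_cmult_left[OF shift(1)[OF n]] pointwise[OF n]])
    also have "\<dots> \<le> (infsum f {1..} + 1) * exp (1 / real k * \<beta> n)"
      using shift(2)[OF n] by (simp add: infsum_cmult_left')
    finally show "kothe_seminorm (power_series_matrix \<beta>) k (hankel_column \<theta> n) \<le>
        (infsum f {1..} + 1) * exp (1 / real k * \<beta> n)" .
  qed
qed

section \<open>The Hankel operator as a column sum\<close>

theorem proposition3p9:
  fixes \<beta> :: "nat \<Rightarrow> real"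
    and a :: "nat \<Rightarrow> nat \<Rightarrow> real"
    and \<theta> :: "nat \<Rightarrow> 'a::{real_normed_field, banach}"
  assumes "\<forall>n\<ge>1. 0 \<le> \<beta> n"
    and "mono_on {1..} \<beta>"
    and "filterlim \<beta> at_top sequentially"
    and "stable_seq \<beta>"
    and "kothe_matrix a"
    and "reindex \<theta> \<in> power_series_space \<beta>"
    and "\<forall>k\<ge>1. \<exists>m\<ge>1. \<exists>C>0. \<forall>n\<ge>1. exp (1 / real k * \<beta> n) \<le> C * a n m"
  shows "hankel_well_defined a (power_series_matrix \<beta>) \<theta> \<and>
    continuous_map (kothe_topology a) (power_series_topology \<beta>)
      (hankel_operator (power_series_matrix \<beta>) \<theta>)"
proof -
  let ?b = "power_series_matrix \<beta>"
  note b = kothe_matrix_power_series_matrix[OF assms(1)]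
  note column_bound = hankel_column_bound[OF assms(1,2,4,6)]
  have column_in: "hankel_column \<theta> n \<in> kothe_space ?b" if "n \<ge> 1" for n
  proof -
    have "(\<lambda>j. norm (hankel_column \<theta> n j) * ?b j k) summable_on {1..}" if "k \<ge> 1" for k
      using column_bound[OF that] \<open>n \<ge> 1\<close> by blast
    then show ?thesis by (simp add: kothe_space_def hankel_column_def)
  qed
  interpret kothe_columns a ?b "hankel_column \<theta>"
  proof
    fix k :: nat assume k: "k \<ge> 1"
    obtain S where S: "S > 0"
      "\<And>n. n \<ge> 1 \<Longrightarrow> kothe_seminorm ?b k (hankel_column \<theta> n) \<le> S * exp (1 / real k * \<beta> n)"
      using column_bound[OF k] by blast
    obtain m C where m: "m \<ge> 1" "C > 0" "\<And>n. n \<ge> 1 \<Longrightarrow> exp (1 / real k * \<beta> n) \<le> C * a n m"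
      using assms(7) k by blast
    \<comment> \<open>\<open>S\<close> comes from \<theta> and stability, \<open>C\<close> from
      comparing the exponentials with \<open>a\<close>.\<close>
    have "kothe_seminorm ?b k (hankel_column \<theta> n) \<le> (S * C) * a n m" if "n \<ge> 1" for n
    proof -
      note S(2)[OF that]
      also have "S * exp (1 / real k * \<beta> n) \<le> S * (C * a n m)"
        by (rule mult_left_mono[OF m(3)[OF that]]) (use S(1) in simp)
      finally show ?thesis by (simp only: mult.assoc)
    qed
    moreover have "S * C > 0" using S(1) m(2) by simp
    ultimately show "\<exists>m\<ge>1. \<exists>C>0. \<forall>n\<ge>1. kothe_seminorm ?b k (hankel_column \<theta> n) \<le> C * a n m"
      using m(1) by blast
  qed (use assms(5) b column_in in auto)
  have lim: "limitin (kothe_topology ?b) (hankel_partial_sum \<theta> x) (column_sum x) sequentially"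
    if "x \<in> kothe_space a" for x
    using limitin_partial_sums[OF that] by (simp add: hankel_partial_sum_def[abs_def])
  \<comment> \<open>Limits are unique in a Hausdorff space, so the description by \<open>THE\<close>
    picks out the column sum.\<close>
  have "hankel_operator ?b \<theta> x = column_sum x" if "x \<in> kothe_space a" for x
    unfolding hankel_operator_def
    by (rule the_equality, rule lim[OF that],
        rule limitin_Hausdorff_unique[OF _ lim[OF that] trivial_limit_sequentially
          Hausdorff_kothe_topology[OF b]])
  \<comment> \<open>The two maps agree on \<open>kothe_space a\<close>, the whole topological space,
    so continuity transfers.\<close>
  then have "continuous_map (kothe_topology a) (kothe_topology ?b) (hankel_operator ?b \<theta>)"
    by (intro continuous_map_eq[OF continuous_map_column_sum]) simp
  moreover have "hankel_well_defined a ?b \<theta>"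
    unfolding hankel_well_defined_def using column_in lim by blast
  ultimately show ?thesis by blast
qed

end
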